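(* Let $D$ be a division ring, $\sigma$ an endomorphism of $D$, $\delta$ a $\sigma$-derivation on $D$, and $R = D[x,\sigma,\delta]$ the skew polynomial ring. Let $f \in R$ and $a \in D$. If $f(a) = a$, then $a$ is a fixed point of $f$, that is, $f^{\circ n}(a) = a$ for all $n \geq 1$.
   Context: Let $D$ be a division ring and $\sigma$ an endomorphism of $D$ (with $\sigma(1)=1$). A $\sigma$-derivation on $D$ is an additive map $\delta: D \to D$ with $\delta(ab) = \sigma(a)\delta(b)+\delta(a)b$ for all $a,b\in D$. The skew polynomial ring $R = D[x,\sigma,\delta]$ consists of the polynomials $\sum f_i x^i$ with coefficients $f_i\in D$ written on the left, with usual addition and with multiplication determined by $xa = \sigma(a)x+\delta(a)$ for $a \in D$. Generalized powers in $D$: for $a\in D$, $a^{[0]} = 1$ and $a^{[n+1]} = \sigma(a^{[n]})a+\delta(a^{[n]})$ for $n\ge 0$. Substitution: for $f = \sum f_i x^i \in R$ and $a \in D$, $f(a) = \sum f_i a^{[i]} \in D$. Extend $\sigma$ and $\delta$ to maps $R\to R$ coefficientwise: $\sigma(\sum f_i x^i) = \sum \sigma(f_i) x^i$ and $\delta(\sum f_i x^i) = \sum \delta(f_i)x^i$ (no claim that these are a ring endomorphism or a $\sigma$-derivation of $R$). For $f\in R$ define $f^{[0]}=1$ and $f^{[n+1]} = \sigma(f^{[n]})f+\delta(f^{[n]})$ for $n \ge 0$ (product in $R$). The formal composition of $f=\sum f_i x^i$ and $g$ in $R$ is $f\circ g = \sum f_i g^{[i]} \in R$. The formal powers are $f^{\circ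 0} = x$ and $f^{\circ(n+1)} = f\circ f^{\circ n}$ for $n \geq 0$. A point $a\in D$ is a fixed point of $f\in R$ if $f^{\circ n}(a) = a$ for all $n\geq 1$. *)

theory Defs
  imports "HOL-Computational_Algebra.Polynomial" "HOL-Algebra.Ring"
begin

locale division_ring_endo =
  fixes \<sigma> :: "'a::division_ring \<Rightarrow> 'a"
  assumes add: "\<sigma> (a + b) = \<sigma> a + \<sigma> b"
    and mult: "\<sigma> (a * b) = \<sigma> a * \<sigma> b"
    and one: "\<sigma> 1 = 1"

locale skew_derivation = division_ring_endo \<sigma>
  for \<sigma> :: "'a::division_ring \<Rightarrow> 'a" +
  fixes \<delta> :: "'a \<Rightarrow> 'a"
  assumes deriv_add: "\<delta> (a + b) = \<delta> a + \<delta> b"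
    and deriv_mult: "\<delta> (a * b) = \<sigma> a * \<delta> b + \<delta> a * b"

text \<open>
  The elements of \<open>D[x,\<sigma>,\<delta>]\<close> are represented by the type \<open>'a poly\<close>, read as left
  polynomials \<open>\<Sum> f\<^sub>i x\<^sup>i\<close>. Only the additive structure of that type is used: its ordinary
  product, evaluation and composition exist for commutative coefficients only.
  Coefficientwise maps are given by \<open>map_poly\<close>.
\<close>

definition left_smult :: "'a::division_ring \<Rightarrow> 'a poly \<Rightarrow> 'a poly" where
  "left_smult c f = map_poly (\<lambda>b. c * b) f"

text \<open>
  Left multiplication by \<open>x\<close>, namely
  \<open>x (\<Sum> g\<^sub>j x\<^sup>j) = \<Sum> (\<sigma> g\<^sub>j x + \<delta> g\<^sub>j) x\<^sup>j\<close>, as forced by \<open>x a = \<sigma> a x + \<delta> a\<close>.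
\<close>

definition skew_X_mult :: "('a::division_ring \<Rightarrow> 'a) \<Rightarrow> ('a \<Rightarrow> 'a) \<Rightarrow> 'a poly \<Rightarrow> 'a poly" where
  "skew_X_mult \<sigma> \<delta> g = pCons 0 (map_poly \<sigma> g) + map_poly \<delta> g"

definition skew_mult ::
  "('a::division_ring \<Rightarrow> 'a) \<Rightarrow> ('a \<Rightarrow> 'a) \<Rightarrow> 'a poly \<Rightarrow> 'a poly \<Rightarrow> 'a poly" where
  "skew_mult \<sigma> \<delta> f g =
     (\<Sum>i\<le>degree f. left_smult (coeff f i) ((skew_X_mult \<sigma> \<delta> ^^ i) g))"

definition skew_poly_ring ::
  "('a::division_ring \<Rightarrow> 'a) \<Rightarrow> ('a \<Rightarrow> 'a) \<Rightarrow> 'a poly ring" where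
  "skew_poly_ring \<sigma> \<delta> =
     \<lparr>carrier = UNIV, monoid.mult = skew_mult \<sigma> \<delta>, one = [:1:], zero = 0, add = (+)\<rparr>"

primrec gen_power ::
  "('a::division_ring \<Rightarrow> 'a) \<Rightarrow> ('a \<Rightarrow> 'a) \<Rightarrow> 'a \<Rightarrow> nat \<Rightarrow> 'a" where
  "gen_power \<sigma> \<delta> a 0 = 1"
| "gen_power \<sigma> \<delta> a (Suc n) = \<sigma> (gen_power \<sigma> \<delta> a n) * a + \<delta> (gen_power \<sigma> \<delta> a n)"

definition skew_eval ::
  "('a::division_ring \<Rightarrow> 'a) \<Rightarrow> ('a \<Rightarrow> 'a) \<Rightarrow> 'a poly \<Rightarrow> 'a \<Rightarrow> 'a" where
  "skew_eval \<sigma> \<delta> f a = (\<Sum>i\<le>degree f. coeff f i * gen_power \<sigma> \<delta> a i)"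

primrec poly_gen_power ::
  "('a::division_ring \<Rightarrow> 'a) \<Rightarrow> ('a \<Rightarrow> 'a) \<Rightarrow> 'a poly \<Rightarrow> nat \<Rightarrow> 'a poly" where
  "poly_gen_power \<sigma> \<delta> f 0 = [:1:]"
| "poly_gen_power \<sigma> \<delta> f (Suc n) =
     skew_mult \<sigma> \<delta> (map_poly \<sigma> (poly_gen_power \<sigma> \<delta> f n)) f
     + map_poly \<delta> (poly_gen_power \<sigma> \<delta> f n)"

definition skew_comp ::
  "('a::division_ring \<Rightarrow> 'a) \<Rightarrow> ('a \<Rightarrow> 'a) \<Rightarrow> 'a poly \<Rightarrow> 'a poly \<Rightarrow> 'a poly" where
  "skew_comp \<sigma> \<delta> f g = (\<Sum>i\<le>degree f. left_smult (coeff f i) (poly_gen_power \<sigma> \<delta> g i))"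

primrec formal_power ::
  "('a::division_ring \<Rightarrow> 'a) \<Rightarrow> ('a \<Rightarrow> 'a) \<Rightarrow> 'a poly \<Rightarrow> nat \<Rightarrow> 'a poly" where
  "formal_power \<sigma> \<delta> f 0 = [:0, 1:]"
| "formal_power \<sigma> \<delta> f (Suc n) = skew_comp \<sigma> \<delta> f (formal_power \<sigma> \<delta> f n)"

definition skew_fixed_point ::
  "('a::division_ring \<Rightarrow> 'a) \<Rightarrow> ('a \<Rightarrow> 'a) \<Rightarrow> 'a poly \<Rightarrow> 'a \<Rightarrow> bool" where
  "skew_fixed_point \<sigma> \<delta> f a \<longleftrightarrow> (\<forall>n\<ge>1. skew_eval \<sigma> \<delta> (formal_power \<sigma> \<delta> f n) a = a)"

text \<open>
  The remaining facts show that \<^const>\<open>skew_mult\<close> is the product of the skew polynomial ring: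
  it is a ring multiplication in which \<open>\<Sum> f\<^sub>i x\<^sup>i\<close> has its usual meaning and
  \<open>x a = \<sigma> a x + \<delta> a\<close>.
\<close>

lemma coeff_left_smult [simp]: "coeff (left_smult c f) n = c * coeff f n"
  by (simp add: left_smult_def coeff_map_poly)

lemma left_smult_simps [simp]:
  "left_smult 0 f = 0" "left_smult c 0 = 0" "left_smult 1 f = f"
  "left_smult (c + d) f = left_smult c f + left_smult d f"
  "left_smult c (f + g) = left_smult c f + left_smult c g"
  "left_smult c (left_smult d f) = left_smult (c * d) f"
  "left_smult c (pCons d f) = pCons (c * d) (left_smult c f)"
  by (simp_all add: poly_eq_iff algebra_simps coeff_pCons split: nat.split)

lemma left_smult_sum: "left_smult c (\<Sum>i\<in>A. f i) = (\<Sum>i\<in>A. left_smult c (f i))"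
  by (induction A rule: infinite_finite_induct) simp_all

context skew_derivation
begin

lemma map_zero [simp]: "\<sigma> 0 = 0" "\<delta> 0 = 0"
  using add[of 0 0] deriv_add[of 0 0] by simp_all

lemma deriv_one [simp]: "\<delta> 1 = 0"
  using deriv_mult[of 1 1] one by simp

abbreviation X_mult where "X_mult \<equiv> skew_X_mult \<sigma> \<delta>"
abbreviation skew_times (infixl "\<star>" 70) where "f \<star> g \<equiv> skew_mult \<sigma> \<delta> f g"

lemma X_mult_add: "X_mult (f + g) = X_mult f + X_mult g"
  by (simp add: poly_eq_iff skew_X_mult_def coeff_map_poly coeff_pCons add deriv_add
      algebra_simps split: nat.split)

lemma X_mult_zero [simp]: "X_mult 0 = 0"
  by (simp add: skew_X_mult_def)

lemma X_mult_left_smult: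
  "X_mult (left_smult c f) = left_smult (\<sigma> c) (X_mult f) + left_smult (\<delta> c) f"
  by (simp add: poly_eq_iff skew_X_mult_def coeff_map_poly coeff_pCons mult deriv_mult
      algebra_simps split: nat.split)

lemma X_mult_pow_add: "(X_mult ^^ n) (f + g) = (X_mult ^^ n) f + (X_mult ^^ n) g"
  by (induction n) (simp_all add: X_mult_add)

lemma skew_mult_bound:
  assumes "degree f \<le> N"
  shows "f \<star> g = (\<Sum>i\<le>N. left_smult (coeff f i) ((X_mult ^^ i) g))"
  unfolding skew_mult_def
  by (rule sum.mono_neutral_left) (use assms in \<open>auto simp: coeff_eq_0\<close>)

lemma skew_mult_add_left: "(f + g) \<star> h = f \<star> h + g \<star> h"
proof -
  let ?N = "max (degree f) (degree g)"
  have "degree (f + g) \<le> ?N" "degree f \<le> ?N" "degree g \<le> ?N"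
    by (simp_all add: degree_add_le_max)
  thus ?thesis
    by (simp add: skew_mult_bound[of _ ?N] sum.distrib)
qed

lemma skew_mult_add_right: "f \<star> (g + h) = f \<star> g + f \<star> h"
  by (simp add: skew_mult_def X_mult_pow_add sum.distrib)

lemma skew_mult_zero_left [simp]: "0 \<star> g = 0"
  by (simp add: skew_mult_def)

lemma skew_mult_pCons: "pCons c f \<star> g = left_smult c g + f \<star> X_mult g"
proof -
  have "degree (pCons c f) \<le> Suc (degree f)"
    by (rule degree_pCons_le)
  hence "pCons c f \<star> g =
      (\<Sum>i\<le>Suc (degree f). left_smult (coeff (pCons c f) i) ((X_mult ^^ i) g))"
    by (rule skew_mult_bound)
  also have "\<dots> = left_smult c g +
      (\<Sum>i\<le>degree f. left_smult (coeff f i) ((X_mult ^^ Suc i) g))"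
    by (subst sum.atMost_Suc_shift) simp
  finally show ?thesis
    by (simp add: skew_mult_def funpow_swap1)
qed

lemma skew_mult_left_smult: "left_smult c f \<star> g = left_smult c (f \<star> g)"
  by (induction f arbitrary: g) (simp_all add: skew_mult_pCons)

lemma skew_mult_X_mult: "X_mult f \<star> g = X_mult (f \<star> g)"
proof (induction f arbitrary: g)
  case (pCons c f)
  have "X_mult f \<star> X_mult g = map_poly \<sigma> f \<star> X_mult (X_mult g) + map_poly \<delta> f \<star> X_mult g"
    by (simp add: skew_X_mult_def[of _ _ f] skew_mult_add_left skew_mult_pCons)
  moreover have "map_poly \<sigma> (pCons c f) = pCons (\<sigma> c) (map_poly \<sigma> f)"
    "map_poly \<delta> (pCons c f) = pCons (\<delta> c) (map_poly \<delta> f)"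
    by (simp_all add: map_poly_pCons)
  ultimately show ?case
    using pCons.IH[of "X_mult g"]
    by (simp add: skew_X_mult_def[of _ _ "pCons c f"] skew_mult_add_left skew_mult_pCons
        X_mult_add X_mult_left_smult algebra_simps)
qed simp

lemma skew_mult_assoc: "(f \<star> g) \<star> h = f \<star> (g \<star> h)"
  by (induction f arbitrary: g)
    (simp_all add: skew_mult_pCons skew_mult_add_left skew_mult_left_smult skew_mult_X_mult)

lemma skew_mult_const: "[:c:] \<star> f = left_smult c f"
  by (simp add: skew_mult_pCons)

lemma skew_mult_X: "[:0, 1:] \<star> f = X_mult f"
  by (simp add: skew_mult_pCons)

lemma X_times_const: "[:0, 1:] \<star> [:c:] = [:\<sigma> c:] \<star> [:0, 1:] + [:\<delta> c:]"
  by (simp add: skew_mult_pCons skew_X_mult_def map_poly_pCons)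

lemma skew_mult_monom: "[:c:] \<star> monom 1 n = monom c n" "[:0, 1:] \<star> monom 1 n = monom 1 (Suc n)"
  by (simp_all add: skew_mult_pCons skew_X_mult_def poly_eq_iff coeff_map_poly coeff_pCons one
      split: nat.split)

lemma skew_mult_one_right: "f \<star> [:1:] = f"
proof -
  have *: "X_mult (monom 1 n) = monom 1 (Suc n)" for n
    using skew_mult_monom(2)[of n] by (simp add: skew_mult_X)
  have "(X_mult ^^ n) [:1:] = monom 1 n" for n
    by (induction n) (simp_all add: monom_0 *)
  hence "f \<star> [:1:] = (\<Sum>i\<le>degree f. monom (coeff f i) i)"
    by (simp add: skew_mult_def left_smult_def map_poly_monom)
  thus ?thesis
    by (simp add: poly_as_sum_of_monoms)
qed

lemma ring_skew_poly_ring: "Ring.ring (skew_poly_ring \<sigma> \<delta>)"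
proof (rule ringI)
  show "abelian_group (skew_poly_ring \<sigma> \<delta>)"
    by (rule abelian_groupI)
      (auto simp: skew_poly_ring_def algebra_simps intro: exI[of _ "- x" for x])
  show "Group.monoid (skew_poly_ring \<sigma> \<delta>)"
    by unfold_locales
      (simp_all add: skew_poly_ring_def skew_mult_assoc skew_mult_const skew_mult_one_right)
qed (simp_all add: skew_poly_ring_def skew_mult_add_left skew_mult_add_right)

end

end

theory Submission
  imports Defs
begin

text \<open>
  Write \<open>T b = \<sigma> b * a + \<delta> b\<close>, so that \<open>a\<^sup>[\<^sup>i\<^sup>] = T\<^sup>i 1\<close>. Evaluation at \<open>a\<close> is
  additive and left linear, and it turns left multiplication by \<open>x\<close> into \<open>T\<close>; hence
  \<open>(p g)(a) = \<Sum> p\<^sub>i T\<^sup>i (g(a))\<close>, which depends on \<open>g\<close> through \<open>g(a)\<close> only.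

  Suppose \<open>g(a) = a = x(a)\<close> and put \<open>h = g\<^sup>[\<^sup>n\<^sup>]\<close>. Then \<open>g\<close> may be replaced by \<open>x\<close> in the
  recursion for the generalized powers: \<open>\<sigma>(h) g + \<delta>(h)\<close> has at \<open>a\<close> the same value as
  \<open>\<sigma>(h) x + \<delta>(h) = x h\<close>, that is, the value \<open>T (h(a))\<close>. By induction
  \<open>g\<^sup>[\<^sup>n\<^sup>](a) = a\<^sup>[\<^sup>n\<^sup>]\<close> for all \<open>n\<close>, so \<open>(f \<circ> g)(a) = f(a)\<close>. If moreover \<open>f(a) = a\<close>, then
  \<open>f \<circ> g\<close> again fixes \<open>a\<close>, and the theorem follows by induction, starting at \<open>f\<^sup>\<circ>\<^sup>0 = x\<close>.
\<close>

context skew_derivation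
begin

text \<open>The additive operator \<open>T\<close> whose iterates on \<open>1\<close> are the generalized powers of \<open>a\<close>.\<close>

definition pow_step :: "'a \<Rightarrow> 'a \<Rightarrow> 'a" where
  "pow_step a b = \<sigma> b * a + \<delta> b"

lemma gen_power_Suc_pow_step:
  "gen_power \<sigma> \<delta> a (Suc n) = pow_step a (gen_power \<sigma> \<delta> a n)"
  by (simp add: pow_step_def)

lemma pow_step_funpow: "(pow_step a ^^ n) a = gen_power \<sigma> \<delta> a (Suc n)"
  by (induction n) (simp_all add: pow_step_def one)

lemma pow_step_add: "pow_step a (b + c) = pow_step a b + pow_step a c"
  by (simp add: pow_step_def add deriv_add algebra_simps)

lemma pow_step_zero: "pow_step a 0 = 0"
  by (simp add: pow_step_def)

lemma pow_step_mult: "pow_step a (b * c) = \<sigma> b * pow_step a c + \<delta> b * c"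
  by (simp add: pow_step_def mult deriv_mult algebra_simps)

lemma pow_step_sum: "pow_step a (\<Sum>i\<in>A. g i) = (\<Sum>i\<in>A. pow_step a (g i))"
  by (induction A rule: infinite_finite_induct) (simp_all add: pow_step_add pow_step_zero)

lemma skew_eval_bound:
  assumes "degree f \<le> N"
  shows "skew_eval \<sigma> \<delta> f a = (\<Sum>i\<le>N. coeff f i * gen_power \<sigma> \<delta> a i)"
  unfolding skew_eval_def
  by (rule sum.mono_neutral_left) (use assms in \<open>auto simp: coeff_eq_0\<close>)

lemma skew_eval_zero: "skew_eval \<sigma> \<delta> 0 a = 0"
  by (simp add: skew_eval_def)

lemma skew_eval_one: "skew_eval \<sigma> \<delta> [:1:] a = 1"
  by (simp add: skew_eval_def)

lemma skew_eval_X: "skew_eval \<sigma> \<delta> [:0, 1:] a = a"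
  by (simp add: skew_eval_def one)

lemma skew_eval_add:
  "skew_eval \<sigma> \<delta> (f + g) a = skew_eval \<sigma> \<delta> f a + skew_eval \<sigma> \<delta> g a"
proof -
  let ?N = "max (degree f) (degree g)"
  have "degree (f + g) \<le> ?N" "degree f \<le> ?N" "degree g \<le> ?N"
    by (simp_all add: degree_add_le_max)
  thus ?thesis
    by (simp add: skew_eval_bound[of _ ?N] sum.distrib distrib_right)
qed

lemma skew_eval_sum:
  "skew_eval \<sigma> \<delta> (\<Sum>i\<in>A. g i) a = (\<Sum>i\<in>A. skew_eval \<sigma> \<delta> (g i) a)"
  by (induction A rule: infinite_finite_induct) (simp_all add: skew_eval_add skew_eval_zero)

lemma skew_eval_left_smult:
  "skew_eval \<sigma> \<delta> (left_smult c f) a = c * skew_eval \<sigma> \<delta> f a"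
proof -
  have "degree (left_smult c f) \<le> degree f"
    by (rule degree_le) (simp add: coeff_eq_0)
  thus ?thesis
    by (simp add: skew_eval_bound[of _ "degree f"] sum_distrib_left mult.assoc)
qed

lemma skew_eval_pCons_zero:
  assumes "degree p \<le> N"
  shows "skew_eval \<sigma> \<delta> (pCons 0 p) a = (\<Sum>i\<le>N. coeff p i * gen_power \<sigma> \<delta> a (Suc i))"
proof -
  have "degree (pCons 0 p) \<le> Suc N"
    using degree_pCons_le[of 0 p] assms by linarith
  thus ?thesis
    by (subst skew_eval_bound[of _ "Suc N"], assumption, subst sum.atMost_Suc_shift) simp
qed

lemma skew_eval_X_mult:
  "skew_eval \<sigma> \<delta> (X_mult g) a = pow_step a (skew_eval \<sigma> \<delta> g a)"
proof -
  have deg: "degree (map_poly \<sigma> g) \<le> degree g" "degree (map_poly \<delta> g) \<le> degree g"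
    by (simp_all add: degree_le coeff_map_poly coeff_eq_0)
  have "skew_eval \<sigma> \<delta> (X_mult g) a =
      (\<Sum>i\<le>degree g. \<sigma> (coeff g i) * gen_power \<sigma> \<delta> a (Suc i)
        + \<delta> (coeff g i) * gen_power \<sigma> \<delta> a i)"
    by (simp add: skew_X_mult_def skew_eval_add skew_eval_pCons_zero[OF deg(1)]
        skew_eval_bound[OF deg(2)] coeff_map_poly sum.distrib del: gen_power.simps)
  also have "\<dots> = pow_step a (skew_eval \<sigma> \<delta> g a)"
    by (simp add: skew_eval_def pow_step_sum pow_step_mult gen_power_Suc_pow_step
        del: gen_power.simps)
  finally show ?thesis .
qed

lemma skew_eval_mult:
  "skew_eval \<sigma> \<delta> (f \<star> g) a =
     (\<Sum>i\<le>degree f. coeff f i * (pow_step a ^^ i) (skew_eval \<sigma> \<delta> g a))"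
proof -
  have "skew_eval \<sigma> \<delta> ((X_mult ^^ i) g) a = (pow_step a ^^ i) (skew_eval \<sigma> \<delta> g a)" for i
    by (induction i) (simp_all add: skew_eval_X_mult)
  thus ?thesis
    by (simp add: skew_mult_def skew_eval_sum skew_eval_left_smult)
qed

text \<open>A right factor that fixes \<open>a\<close> can be replaced by \<open>x\<close>: the right-hand side is \<open>p x\<close>.\<close>

lemma skew_eval_mult_fixing:
  assumes "skew_eval \<sigma> \<delta> g a = a"
  shows "skew_eval \<sigma> \<delta> (p \<star> g) a = skew_eval \<sigma> \<delta> (pCons 0 p) a"
  by (simp add: skew_eval_mult assms pow_step_funpow skew_eval_pCons_zero[OF order_refl]
      del: gen_power.simps)

lemma skew_eval_poly_gen_power:
  assumes "skew_eval \<sigma> \<delta> g a = a"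
  shows "skew_eval \<sigma> \<delta> (poly_gen_power \<sigma> \<delta> g n) a = gen_power \<sigma> \<delta> a n"
proof (induction n)
  case 0
  show ?case
    by (simp add: skew_eval_one)
next
  case (Suc n)
  let ?h = "poly_gen_power \<sigma> \<delta> g n"
  have "skew_eval \<sigma> \<delta> (poly_gen_power \<sigma> \<delta> g (Suc n)) a = skew_eval \<sigma> \<delta> (X_mult ?h) a"
    by (simp add: skew_eval_add skew_eval_mult_fixing[OF assms] skew_X_mult_def)
  also have "\<dots> = gen_power \<sigma> \<delta> a (Suc n)"
    by (simp only: skew_eval_X_mult Suc.IH gen_power_Suc_pow_step)
  finally show ?case .
qed

lemma skew_eval_comp_fixing:
  assumes "skew_eval \<sigma> \<delta> g a = a"
  shows "skew_eval \<sigma> \<delta> (skew_comp \<sigma> \<delta> f g) a = skew_eval \<sigma> \<delta> f a"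
  by (simp add: skew_comp_def skew_eval_sum skew_eval_left_smult
      skew_eval_poly_gen_power[OF assms] skew_eval_def[of _ _ f])

lemma skew_eval_formal_power:
  assumes "skew_eval \<sigma> \<delta> f a = a"
  shows "skew_eval \<sigma> \<delta> (formal_power \<sigma> \<delta> f n) a = a"
  by (induction n) (simp_all add: skew_eval_X skew_eval_comp_fixing assms)

end

theorem theorem3p2:
  fixes \<sigma> \<delta> :: "'a::division_ring \<Rightarrow> 'a"
    and f :: "'a poly" and a :: 'a
  assumes "skew_derivation \<sigma> \<delta>"
    and "skew_eval \<sigma> \<delta> f a = a"
  shows "skew_fixed_point \<sigma> \<delta> f a"
  using skew_derivation.skew_eval_formal_power[OF assms]
  by (simp add: skew_fixed_point_def)

end
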